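(* Let $(G,\mathsf{X})$ and $(H,\mathsf{Y})$ be finite permutation groups such that $(G,\mathsf{X})$ is isomorphic as a permutation group to a subgroup of the wreath product of finitely many copies of $(H,\mathsf{Y})$ (that is, for some $r\ge 1$, to a subgroup of the permutational wreath product of $r$ copies of $(H,\mathsf{Y})$ acting on $\mathsf{Y}^r$). Then every group generated by a finite automaton over $\mathsf{X}$ such that the permutation group defined at its states is $(G,\mathsf{X})$ can be generated by a finite automaton over $\mathsf{Y}$ such that the permutation group defined at its states is $(H,\mathsf{Y})$.
   Context: Permutation groups act on the right, the action being written $x^g$. Permutational wreath product: the wreath product of $r$ copies of $(H,\mathsf{Y})$ consists of all tuples $[h_1,h_2(y_1),\ldots,h_r(y_1,\ldots,y_{r-1})]$ with $h_1\in H$ and $h_i:\mathsf{Y}^{i-1}\to H$ for $2\le i\le r$, acting on $\mathsf{Y}^r$ by $(y_1,\ldots,y_r)\mapsto(y_1^{h_1},y_2^{h_2(y_1)},\ldots,y_r^{h_r(y_1,\ldots,y_{r-1})})$. Permutation groups $(A,\mathsf{U})$ and $(B,\mathsf{V})$ are isomorphic as permutation groups if there are a group isomorphism $\varphi:A\to B$ and a bijection $\psi:\mathsf{U}\to\mathsf{V}$ with $\psi(u^a)=\psi(u)^{\varphi(a)}$ for all $u\in\mathsf{U}$, $a\in A$. Automata: an alphabet is a finite set with more than one element; $\mathsf{X}^*$ is the set of all finite words over $\mathsf{X}$, including the empty word $\Lambda$. A finite automaton over an alphabet $\mathsf{X}$ is a triple $\mathcal{A}=(Q,\lambda,\mu)$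 where $Q$ is a finite non-empty set (of states), $\lambda:Q\times\mathsf{X}\to Q$ is the transition function and $\mu:Q\times\mathsf{X}\to\mathsf{X}$ is the output function. It is permutational if for every $q\in Q$ the map $\mu_q=\mu(q,\cdot):\mathsf{X}\to\mathsf{X}$ is a permutation of $\mathsf{X}$. All automata are assumed finite and permutational. The permutation group defined at states of $\mathcal{A}$ is the subgroup of the symmetric group on $\mathsf{X}$ generated by $\{\mu_q : q\in Q\}$, regarded as a permutation group on $\mathsf{X}$. Each $\mu_q$ extends to a permutation of $\mathsf{X}^*$ (the automaton permutation at state $q$) by $\mu_q(\Lambda)=\Lambda$ and $\mu_q(xw)=\mu_q(x)\mu_{\lambda(q,x)}(w)$ for $x\in\mathsf{X}$, $w\in\mathsf{X}^*$. A group is said to be generated by the finite automaton $\mathcal{A}$ over $\mathsf{X}$ if it is isomorphic to the group of permutations of $\mathsf{X}^*$ generated by some subset of the set of automaton permutations $\{\mu_q : q\in Q\}$. *)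

theory Defs
  imports "HOL-Combinatorics.Permutations" "HOL-Algebra.Generated_Groups"
begin

section \<open>Permutation groups acting on the right\<close>

text \<open>
  Permutations of a set \<open>X\<close> are functions that permute \<open>X\<close> and are the identity outside \<open>X\<close>.
  Groups act on the right, so the product \<open>f g\<close> means: first \<open>f\<close>, then \<open>g\<close>; the point
  \<open>x\<^sup>g\<close> is written \<open>g x\<close>.
\<close>

definition symmetric_group :: "'a set \<Rightarrow> ('a \<Rightarrow> 'a) monoid" where
  "symmetric_group X = \<lparr>carrier = {p. p permutes X}, mult = (\<lambda>f g. g \<circ> f), one = id\<rparr>"

definition finite_perm_group :: "('a \<Rightarrow> 'a) set \<Rightarrow> 'a set \<Rightarrow> bool" where
  "finite_perm_group G X \<longleftrightarrow> finite X \<and> subgroup G (symmetric_group X)"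

definition perm_isomorphic :: "('a \<Rightarrow> 'a) set \<Rightarrow> 'a set \<Rightarrow> ('b \<Rightarrow> 'b) set \<Rightarrow> 'b set \<Rightarrow> bool" where
  "perm_isomorphic A U B V \<longleftrightarrow>
     (\<exists>\<phi> \<psi>. \<phi> \<in> iso (symmetric_group U\<lparr>carrier := A\<rparr>) (symmetric_group V\<lparr>carrier := B\<rparr>) \<and>
            bij_betw \<psi> U V \<and> (\<forall>u\<in>U. \<forall>a\<in>A. \<psi> (a u) = \<phi> a (\<psi> u)))"

lemma group_symmetric_group: "group (symmetric_group X)"
proof (rule groupI)
  fix p assume "p \<in> carrier (symmetric_group X)"
  then have "p permutes X" by (simp add: symmetric_group_def)
  then show "\<exists>q\<in>carrier (symmetric_group X).
      q \<otimes>\<^bsub>symmetric_group X\<^esub> p = \<one>\<^bsub>symmetric_group X\<^esub>"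
    by (intro bexI[of _ "inv_into UNIV p"])
       (auto simp: symmetric_group_def permutes_inv permutes_inv_o)
qed (auto simp: symmetric_group_def permutes_compose permutes_id comp_assoc)


section \<open>Permutational wreath products\<close>

definition tuples :: "'y set \<Rightarrow> nat \<Rightarrow> 'y list set" where
  "tuples Y n = {ys \<in> lists Y. length ys = n}"

text \<open>
  A tuple \<open>[h\<^sub>1, h\<^sub>2(y\<^sub>1), \<dots>, h\<^sub>r(y\<^sub>1,\<dots>,y\<^sub>r\<^sub>-\<^sub>1)]\<close> is encoded with indices shifted to start at 0:
  \<open>h i\<close> is the function of the first \<open>i\<close> coordinates that acts on the next one. In
  particular \<open>h 0\<close> only matters at the empty list, which represents an element of \<open>H\<close>.
\<close>

definition wreath_act ::
    "'y set \<Rightarrow> nat \<Rightarrow> (nat \<Rightarrow> 'y list \<Rightarrow> 'y \<Rightarrow> 'y) \<Rightarrow> 'y list \<Rightarrow> 'y list" where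
  "wreath_act Y r h ys =
     (if ys \<in> tuples Y r then map (\<lambda>i. h i (take i ys) (ys ! i)) [0..<r] else ys)"

definition wreath_power :: "('y \<Rightarrow> 'y) set \<Rightarrow> 'y set \<Rightarrow> nat \<Rightarrow> ('y list \<Rightarrow> 'y list) set" where
  "wreath_power H Y r = {wreath_act Y r h | h. \<forall>i<r. \<forall>u\<in>tuples Y i. h i u \<in> H}"


section \<open>Finite permutational automata\<close>

definition alphabet :: "'x set \<Rightarrow> bool" where
  "alphabet X \<longleftrightarrow> finite X \<and> card X > 1"

record ('q, 'x) automaton =
  states :: "'q set"
  transition :: "'q \<Rightarrow> 'x \<Rightarrow> 'q"
  out :: "'q \<Rightarrow> 'x \<Rightarrow> 'x"

definition automaton_over :: "'x set \<Rightarrow> ('q, 'x) automaton \<Rightarrow> bool" where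
  "automaton_over X A \<longleftrightarrow>
     alphabet X \<and> finite (states A) \<and> states A \<noteq> {} \<and>
     (\<forall>q\<in>states A. \<forall>x\<in>X. transition A q x \<in> states A) \<and>
     (\<forall>q\<in>states A. out A q permutes X)"

definition state_group :: "'x set \<Rightarrow> ('q, 'x) automaton \<Rightarrow> ('x \<Rightarrow> 'x) set" where
  "state_group X A = generate (symmetric_group X) (out A ` states A)"

primrec run :: "('q, 'x) automaton \<Rightarrow> 'q \<Rightarrow> 'x list \<Rightarrow> 'x list" where
  "run A q [] = []"
| "run A q (x # w) = out A q x # run A (transition A q x) w"

text \<open>The automaton permutation of \<open>lists X\<close> at a state, the identity outside \<open>lists X\<close>.\<close>

definition automaton_perm :: "'x set \<Rightarrow> ('q, 'x) automaton \<Rightarrow> 'q \<Rightarrow> 'x list \<Rightarrow> 'x list" where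
  "automaton_perm X A q w = (if w \<in> lists X then run A q w else w)"

definition generated_by_automaton ::
    "('g, 'm) monoid_scheme \<Rightarrow> 'x set \<Rightarrow> ('q, 'x) automaton \<Rightarrow> bool" where
  "generated_by_automaton \<Gamma> X A \<longleftrightarrow>
     (\<exists>S \<subseteq> automaton_perm X A ` states A.
        \<Gamma> \<cong> symmetric_group (lists X)\<lparr>carrier := generate (symmetric_group (lists X)) S\<rparr>)"

lemma automaton_perm_permutes:
  assumes A: "automaton_over X A" and q: "q \<in> states A"
  shows "automaton_perm X A q permutes lists X"
proof -
  have out: "out A q permutes X" if "q \<in> states A" for q
    using A that by (simp add: automaton_over_def)
  have tr: "transition A q x \<in> states A" if "q \<in> states A" "x \<in> X" for q x
    using A that by (simp add: automaton_over_def)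
  have closed: "run A q w \<in> lists X" if "w \<in> lists X" "q \<in> states A" for w q
    using that
    by (induction w arbitrary: q rule: lists.induct) (auto simp: permutes_in_image[OF out] tr)
  have inj: "w = v" if "w \<in> lists X" "v \<in> lists X" "q \<in> states A" "run A q w = run A q v" for w v q
    using that
  proof (induction w arbitrary: q v rule: lists.induct)
    case Nil
    then show ?case by (cases v) auto
  next
    case (Cons x w)
    from Cons.prems obtain y u where v: "v = y # u" by (cases v) auto
    with Cons.prems have "out A q x = out A q y" by simp
    then have "x = y" using permutes_inj[OF out[OF Cons.prems(2)]] by (simp add: inj_eq)
    moreover have "w = u"
      using Cons.IH[of u "transition A q x"] Cons.prems v \<open>x = y\<close> Cons.hyps(1) tr by auto
    ultimately show ?case using v by simp
  qed
  have surj: "\<exists>w\<in>lists X. run A q w = v" if "v \<in> lists X" "q \<in> states A" for v q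
    using that
  proof (induction v arbitrary: q rule: lists.induct)
    case Nil
    then show ?case by (intro bexI[of _ "[]"]) auto
  next
    case (Cons y v)
    obtain x where x: "x \<in> X" "out A q x = y"
      using permutes_image[OF out[OF Cons.prems]] Cons.hyps(1) by (metis imageE)
    obtain w where "w \<in> lists X" "run A (transition A q x) w = v"
      using Cons.IH tr[OF Cons.prems x(1)] by blast
    with x show ?case by (intro bexI[of _ "x # w"]) auto
  qed
  have "bij_betw (automaton_perm X A q) (lists X) (lists X)"
  proof (rule bij_betwI')
    fix w v assume "w \<in> lists X" "v \<in> lists X"
    then show "automaton_perm X A q w = automaton_perm X A q v \<longleftrightarrow> w = v"
      using inj q by (auto simp: automaton_perm_def)
  next
    fix w assume "w \<in> lists X"
    then show "automaton_perm X A q w \<in> lists X"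
      using closed[OF _ q] by (simp add: automaton_perm_def)
  next
    fix v assume "v \<in> lists X"
    then obtain w where "w \<in> lists X" "run A q w = v" using surj q by blast
    then show "\<exists>w\<in>lists X. v = automaton_perm X A q w"
      by (intro bexI[of _ w]) (auto simp: automaton_perm_def)
  qed
  then show ?thesis by (rule bij_imp_permutes) (simp add: automaton_perm_def)
qed

end

theory Submission
  imports Defs
begin

text \<open>
  A bijection \<open>\<psi>\<close> from \<open>X\<close> to \<open>Y\<^sup>r\<close> codes words over \<open>X\<close> as words over \<open>Y\<close> whose length is a
  multiple of \<open>r\<close>. An automaton over \<open>X\<close> is simulated on codes by an automaton over \<open>Y\<close> whose
  states remember a state of the original automaton and the part of the current block read so
  far: by the wreath product hypothesis, the letter at position \<open>i\<close> of a block is transformed by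
  an element of \<open>H\<close> that depends only on the preceding letters of the block. Since automaton
  permutations preserve prefixes and every word over \<open>Y\<close> is a prefix of a code, such a permutation
  is determined by its action on codes, so restriction to codes is an injective homomorphism.
  Finally, all elements of \<open>H\<close> are added as outputs at further states, which the generating
  subset does not use.
\<close>

section \<open>Words and automata\<close>

lemma finite_tuples: "finite Y \<Longrightarrow> finite (tuples Y n)"
  using finite_lists_length_eq[of Y n] by (simp add: tuples_def lists_eq_set)

text \<open>Serves to show that \<open>Y\<close> has at least two letters: otherwise at most one
  tuple could be matched with the letters of \<open>X\<close>.\<close>

lemma tuples_subset_singleton: "Y \<subseteq> {y} \<Longrightarrow> tuples Y n \<subseteq> {replicate n y}"
  by (auto simp: tuples_def lists_eq_set intro!: replicate_eqI)

lemma run_take: "run A q (take n w) = take n (run A q w)"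
proof (induction w arbitrary: q n)
  case (Cons x w)
  then show ?case by (cases n) auto
qed simp

lemma automaton_perm_take:
  assumes "w \<in> lists X"
  shows "automaton_perm X A q (take n w) = take n (automaton_perm X A q w)"
  using assms by (auto simp: automaton_perm_def run_take lists_eq_set dest: in_set_takeD)

text \<open>The state group and the generated groups depend on the states only through the set of
  outputs and the set of automaton permutations; an injective renaming preserves both.\<close>

lemma automaton_nat_states:
  fixes B :: "('s, 'y) automaton"
  assumes B: "automaton_over Y B" and gen: "generated_by_automaton \<Gamma> Y B"
  shows "\<exists>C :: (nat, 'y) automaton. automaton_over Y C \<and> state_group Y C = state_group Y B \<and>
           generated_by_automaton \<Gamma> Y C"
proof -
  have "finite (states B)" using B by (simp add: automaton_over_def)
  then obtain f :: "'s \<Rightarrow> nat" where f: "inj_on f (states B)"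
    using finite_imp_inj_to_nat_seg by blast
  define g where "g = inv_into (states B) f"
  have g [simp]: "g (f s) = s" if "s \<in> states B" for s
    using f that by (simp add: g_def)
  define C where "C = \<lparr>states = f ` states B, transition = (\<lambda>n y. f (transition B (g n) y)),
    out = (\<lambda>n. out B (g n))\<rparr>"
  have tr: "transition B s y \<in> states B" if "s \<in> states B" "y \<in> Y" for s y
    using B that by (simp add: automaton_over_def)
  have "run C (f s) w = run B s w" if "s \<in> states B" "w \<in> lists Y" for s w
    using that(2,1) by (induction w arbitrary: s rule: lists.induct) (auto simp: C_def tr)
  then have perm: "automaton_perm Y C (f s) = automaton_perm Y B s" if "s \<in> states B" for s
    using that by (auto simp: automaton_perm_def)
  have "automaton_over Y C"
    using B by (auto simp: automaton_over_def C_def)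
  moreover have "out C ` states C = out B ` states B"
    by (force simp: C_def)
  moreover have "automaton_perm Y C ` states C = automaton_perm Y B ` states B"
    using perm by (force simp: C_def)
  ultimately show ?thesis
    using gen by (metis generated_by_automaton_def state_group_def)
qed

lemma symmetric_group_simps [simp]:
  "carrier (symmetric_group X) = {p. p permutes X}"
  "p \<otimes>\<^bsub>symmetric_group X\<^esub> q = q \<circ> p"
  "\<one>\<^bsub>symmetric_group X\<^esub> = id"
  by (simp_all add: symmetric_group_def)

lemma inv_symmetric_group:
  assumes "p permutes X"
  shows "inv\<^bsub>symmetric_group X\<^esub> p = inv_into UNIV p"
  by (rule group.inv_equality[OF group_symmetric_group])
    (simp_all add: assms permutes_inv permutes_inv_o[OF assms])


section \<open>Restriction to codes\<close>

locale block_code =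
  fixes X :: "'x set" and Y :: "'y set" and r :: nat and \<psi> :: "'x \<Rightarrow> 'y list"
  assumes psi: "bij_betw \<psi> X (tuples Y r)" and r_pos: "r > 0" and Y_ne: "Y \<noteq> {}"
begin

definition code :: "'x list \<Rightarrow> 'y list" where
  "code w = concat (map \<psi> w)"

lemma code_simps [simp]: "code [] = []" "code (x # w) = \<psi> x @ code w"
  by (simp_all add: code_def)

lemma psi_in: "x \<in> X \<Longrightarrow> \<psi> x \<in> tuples Y r"
  using psi by (auto simp: bij_betw_def)

lemma length_psi: "x \<in> X \<Longrightarrow> length (\<psi> x) = r"
  using psi_in by (simp add: tuples_def)

lemma code_in_lists: "w \<in> lists X \<Longrightarrow> code w \<in> lists Y"
  by (induction w rule: lists.induct) (use psi_in in \<open>auto simp: tuples_def\<close>)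

text \<open>All blocks have length \<open>r\<close>, so the first one can be split off and decoded;
  \<open>r > 0\<close> tells the empty word from the others.\<close>

lemma inj_on_code: "inj_on code (lists X)"
proof (rule inj_onI)
  fix w v assume "w \<in> lists X" "v \<in> lists X" "code w = code v"
  then show "w = v"
  proof (induction w arbitrary: v rule: lists.induct)
    case Nil
    then show ?case using r_pos length_psi[of "hd v"] by (cases v) auto
  next
    case (Cons x w)
    then have "v \<noteq> []" using r_pos length_psi[of x] by auto
    with Cons.prems obtain y u where v: "v = y # u" "y \<in> X" "u \<in> lists X"
      by (cases v) auto
    then have "\<psi> x = \<psi> y" "code w = code u"
      using Cons.prems length_psi[OF Cons.hyps(1)] length_psi[of y] by simp_all
    then show ?case
      using Cons.IH[of u] Cons.hyps(1) v bij_betw_imp_inj_on[OF psi] by (auto dest: inj_onD)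
  qed
qed

lemma code_surj:
  assumes "v \<in> lists Y" "length v = k * r"
  shows "v \<in> code ` lists X"
  using assms
proof (induction k arbitrary: v)
  case 0
  then show ?case by (auto intro: image_eqI[of _ _ "[]"])
next
  case (Suc k)
  have "take r v \<in> tuples Y r"
    using Suc.prems by (auto simp: tuples_def lists_eq_set dest: in_set_takeD)
  then obtain x where x: "x \<in> X" "\<psi> x = take r v"
    using psi by (metis bij_betw_def imageE)
  have "drop r v \<in> code ` lists X"
    using Suc.prems by (intro Suc.IH) (auto simp: lists_eq_set dest: in_set_dropD)
  then obtain w where "w \<in> lists X" "drop r v = code w" by blast
  with x have "code (x # w) = v" "x # w \<in> lists X"
    using append_take_drop_id[of r v] by simp_all
  then show ?case by blast
qed

lemma prefix_of_code:
  assumes "v \<in> lists Y"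
  obtains w where "w \<in> lists X" "v = take (length v) (code w)"
proof -
  obtain y where y: "y \<in> Y" using Y_ne by blast
  \<comment> \<open>Padding goes up to \<open>length v * r\<close>, a multiple of \<open>r\<close>
    that is at least \<open>length v\<close> since \<open>r > 0\<close>.\<close>
  have "length v \<le> length v * r" using r_pos by simp
  then have "v @ replicate (length v * r - length v) y \<in> code ` lists X"
    using assms y by (intro code_surj[of _ "length v"]) (auto simp: lists_eq_set)
  then show thesis using that by (metis append_eq_conv_conj imageE)
qed

section \<open>Permutations of words over \<open>Y\<close> that preserve prefixes and codes\<close>

definition code_perms :: "('y list \<Rightarrow> 'y list) set" where
  "code_perms = {p. p permutes lists Y \<and> (\<forall>v\<in>lists Y. \<forall>n. p (take n v) = take n (p v)) \<and>
     p ` code ` lists X = code ` lists X}"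

definition code_restrict :: "('y list \<Rightarrow> 'y list) \<Rightarrow> 'x list \<Rightarrow> 'x list" where
  "code_restrict p w = (if w \<in> lists X then inv_into (lists X) code (p (code w)) else w)"

lemma subgroup_code_perms: "subgroup code_perms (symmetric_group (lists Y))"
proof (rule group.subgroupI[OF group_symmetric_group])
  show "code_perms \<subseteq> carrier (symmetric_group (lists Y))"
    by (auto simp: code_perms_def)
  have "id \<in> code_perms" by (simp add: code_perms_def permutes_id)
  then show "code_perms \<noteq> {}" by blast
next
  fix p assume p: "p \<in> code_perms"
  then have perm: "p permutes lists Y" by (simp add: code_perms_def)
  \<comment> \<open>Since \<open>p\<close> commutes with \<open>take n\<close>, it sends
    \<open>take n\<close> of the preimage of \<open>v\<close> to \<open>take n v\<close>; applying
    the inverse gives the claim.\<close>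
  have "inv_into UNIV p (take n v) = take n (inv_into UNIV p v)" if v: "v \<in> lists Y" for n v
  proof -
    have "inv_into UNIV p v \<in> lists Y"
      using v permutes_in_image[OF permutes_inv[OF perm]] by blast
    then have "p (take n (inv_into UNIV p v)) = take n (p (inv_into UNIV p v))"
      using p by (simp add: code_perms_def)
    then show ?thesis
      by (metis perm permutes_inverses)
  qed
  \<comment> \<open>An equality of images, unlike an inclusion, passes to the inverse at
    once.\<close>
  moreover have "inv_into UNIV p ` code ` lists X = code ` lists X"
  proof -
    have "p ` code ` lists X = code ` lists X" using p by (simp add: code_perms_def)
    then show ?thesis by (metis image_inv_f_f perm permutes_inj)
  qed
  ultimately show "inv\<^bsub>symmetric_group (lists Y)\<^esub> p \<in> code_perms"
    using perm by (simp add: inv_symmetric_group code_perms_def permutes_inv)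
next
  fix p q assume p: "p \<in> code_perms" and q: "q \<in> code_perms"
  have "p v \<in> lists Y" if "v \<in> lists Y" for v
    using p that permutes_in_image[of p "lists Y"] by (simp add: code_perms_def)
  moreover have "(q \<circ> p) ` code ` lists X = code ` lists X"
    using p q by (simp add: code_perms_def image_comp[symmetric] del: image_image o_apply)
  ultimately show "p \<otimes>\<^bsub>symmetric_group (lists Y)\<^esub> q \<in> code_perms"
    using p q by (simp add: code_perms_def permutes_compose)
qed

lemma code_restrict_code:
  assumes p: "p \<in> code_perms" and w: "w \<in> lists X"
  shows "code_restrict p w \<in> lists X" "code (code_restrict p w) = p (code w)"
proof -
  have "p ` code ` lists X = code ` lists X" using p by (simp add: code_perms_def)
  then have "p (code w) \<in> code ` lists X" using w by blast
  then show "code_restrict p w \<in> lists X" "code (code_restrict p w) = p (code w)"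
    using w by (simp_all add: code_restrict_def inv_into_into f_inv_into_f)
qed

lemma code_restrict_eqI:
  assumes "w \<in> lists X" "v \<in> lists X" "p (code w) = code v"
  shows "code_restrict p w = v"
  using assms inj_on_code by (simp add: code_restrict_def)

lemma code_restrict_permutes:
  assumes p: "p \<in> code_perms"
  shows "code_restrict p permutes lists X"
proof (rule bij_imp_permutes)
  have perm: "p permutes lists Y" and im: "p ` code ` lists X = code ` lists X"
    using p by (simp_all add: code_perms_def)
  show "bij_betw (code_restrict p) (lists X) (lists X)"
  proof (rule bij_betwI')
    fix w v assume wv: "w \<in> lists X" "v \<in> lists X"
    show "code_restrict p w = code_restrict p v \<longleftrightarrow> w = v"
    proof
      assume "code_restrict p w = code_restrict p v"
      then have "p (code w) = p (code v)"
        using code_restrict_code(2)[OF p] wv by metis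
      then show "w = v"
        using permutes_inj[OF perm] inj_on_code wv by (simp add: inj_eq inj_on_eq_iff)
    qed simp
  next
    fix w assume "w \<in> lists X"
    then show "code_restrict p w \<in> lists X" by (rule code_restrict_code[OF p])
  next
    fix v assume v: "v \<in> lists X"
    then have "code v \<in> p ` code ` lists X" using im by blast
    then obtain w where "w \<in> lists X" "p (code w) = code v"
      by (metis imageE)
    then show "\<exists>w\<in>lists X. v = code_restrict p w"
      using code_restrict_eqI v by blast
  qed
qed (simp add: code_restrict_def)

lemma inj_on_code_restrict: "inj_on code_restrict code_perms"
proof (rule inj_onI)
  fix p q assume p: "p \<in> code_perms" and q: "q \<in> code_perms"
    and eq: "code_restrict p = code_restrict q"
  have take: "p (take n v) = take n (p v)" "q (take n v) = take n (q v)" if "v \<in> lists Y" for v n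
    using p q that by (simp_all add: code_perms_def)
  have on_lists: "p v = q v" if v: "v \<in> lists Y" for v
  proof -
    obtain w where w: "w \<in> lists X" and "v = take (length v) (code w)"
      using prefix_of_code[OF v] .
    moreover have "p (code w) = q (code w)"
      using code_restrict_code[OF p w] code_restrict_code[OF q w] eq by simp
    \<comment> \<open>Both permutations commute with truncation to \<open>length v\<close>, so
      agreement at \<open>code w\<close> descends to its prefix \<open>v\<close>.\<close>
    ultimately show ?thesis
      using take[OF code_in_lists[OF w]] by metis
  qed
  have "p permutes lists Y" "q permutes lists Y"
    using p q by (simp_all add: code_perms_def)
  then have "p v = q v" for v
    by (cases "v \<in> lists Y") (simp_all add: on_lists permutes_not_in)
  then show "p = q" by blast
qed

lemma group_hom_code_restrict:
  "group_hom (symmetric_group (lists Y)\<lparr>carrier := code_perms\<rparr>) (symmetric_group (lists X))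
     code_restrict"
proof (intro group_hom.intro group_hom_axioms.intro homI)
  show "group (symmetric_group (lists Y)\<lparr>carrier := code_perms\<rparr>)"
    by (rule group.subgroup_imp_group[OF group_symmetric_group subgroup_code_perms])
  show "group (symmetric_group (lists X))" by (rule group_symmetric_group)
next
  fix p assume "p \<in> carrier (symmetric_group (lists Y)\<lparr>carrier := code_perms\<rparr>)"
  then show "code_restrict p \<in> carrier (symmetric_group (lists X))"
    by (simp add: code_restrict_permutes)
next
  fix p q assume "p \<in> carrier (symmetric_group (lists Y)\<lparr>carrier := code_perms\<rparr>)"
    "q \<in> carrier (symmetric_group (lists Y)\<lparr>carrier := code_perms\<rparr>)"
  then have p: "p \<in> code_perms" and q: "q \<in> code_perms" by simp_all
  \<comment> \<open>Products are read from left to right, so the product of \<open>p\<close> and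
    \<open>q\<close> is the function \<open>q \<circ> p\<close>.\<close>
  have "code_restrict (q \<circ> p) w = code_restrict q (code_restrict p w)" for w
  proof (cases "w \<in> lists X")
    case True
    note p_w = code_restrict_code[OF p True]
    show ?thesis
      using True p_w code_restrict_code[OF q p_w(1)] by (intro code_restrict_eqI) simp_all
  next
    case False
    then show ?thesis unfolding code_restrict_def by simp
  qed
  then show "code_restrict (p \<otimes>\<^bsub>symmetric_group (lists Y)\<lparr>carrier := code_perms\<rparr>\<^esub> q) =
      code_restrict p \<otimes>\<^bsub>symmetric_group (lists X)\<^esub> code_restrict q"
    by (simp add: fun_eq_iff)
qed

text \<open>A homomorphism maps the subgroup generated by \<open>S\<close> onto the one generated by
  the image of \<open>S\<close>; injectivity on \<open>code_perms\<close> makes this an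
  isomorphism.\<close>

lemma generate_code_restrict_iso:
  assumes S: "S \<subseteq> code_perms"
  shows "symmetric_group (lists X)\<lparr>carrier :=
      generate (symmetric_group (lists X)) (code_restrict ` S)\<rparr> \<cong>
    symmetric_group (lists Y)\<lparr>carrier := generate (symmetric_group (lists Y)) S\<rparr>"
    (is "?GX \<cong> ?GY")
proof -
  let ?SY = "symmetric_group (lists Y)"
  interpret SY: group ?SY by (rule group_symmetric_group)
  interpret hom: group_hom "?SY\<lparr>carrier := code_perms\<rparr>" "symmetric_group (lists X)" code_restrict
    by (rule group_hom_code_restrict)
  have sub: "generate ?SY S \<subseteq> code_perms"
    by (rule SY.generate_subgroup_incl[OF S subgroup_code_perms])
  \<comment> \<open>Generating inside \<open>code_perms\<close> or inside the whole symmetric group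
    gives the same subgroup.\<close>
  have im: "code_restrict ` generate ?SY S = carrier ?GX"
    using hom.generate_img[of S] S SY.generate_consistent[OF S subgroup_code_perms] by simp
  have "bij_betw code_restrict (carrier ?GY) (carrier ?GX)"
    using im inj_on_subset[OF inj_on_code_restrict sub] by (simp add: bij_betw_def)
  moreover have "code_restrict \<in> hom ?GY ?GX"
  proof (rule homI)
    show "code_restrict p \<in> carrier ?GX" if "p \<in> carrier ?GY" for p
      using im that by auto
    show "code_restrict (p \<otimes>\<^bsub>?GY\<^esub> q) = code_restrict p \<otimes>\<^bsub>?GX\<^esub> code_restrict q"
      if "p \<in> carrier ?GY" "q \<in> carrier ?GY" for p q
      using hom.hom_mult[of p q] that sub by auto
  qed
  ultimately have "code_restrict \<in> iso ?GY ?GX"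
    by (simp add: iso_def)
  \<comment> \<open>\<open>code_restrict\<close> leads from \<open>?GY\<close> to
    \<open>?GX\<close>, so the isomorphism must be inverted; \<open>iso_sym\<close> does this for a
    group \<open>?GY\<close>.\<close>
  moreover have "group ?GY"
    using S subgroup.subset[OF subgroup_code_perms]
    by (intro SY.subgroup_imp_group SY.generate_is_subgroup) auto
  ultimately show ?thesis
    by (meson group.iso_sym is_isoI)
qed

end


section \<open>The simulating automaton\<close>

text \<open>\<open>h q\<close> holds the wreath coordinates of the permutation of
  \<open>tuples Y r\<close> to which \<open>\<psi>\<close> carries \<open>out A q\<close>.\<close>

locale block_automaton = block_code X Y r \<psi>
  for X :: "'x set" and Y :: "'y set" and r \<psi> +
  fixes A :: "('q, 'x) automaton" and H :: "('y \<Rightarrow> 'y) set"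
    and h :: "'q \<Rightarrow> nat \<Rightarrow> 'y list \<Rightarrow> 'y \<Rightarrow> 'y"
  assumes A: "automaton_over X A"
    and Y: "alphabet Y"
    and H: "subgroup H (symmetric_group Y)"
    and h_in: "\<lbrakk>q \<in> states A; i < r; u \<in> tuples Y i\<rbrakk> \<Longrightarrow> h q i u \<in> H"
    and psi_out: "\<lbrakk>q \<in> states A; x \<in> X\<rbrakk> \<Longrightarrow> \<psi> (out A q x) = wreath_act Y r (h q) (\<psi> x)"
begin

text \<open>In a state \<open>Inl (q, u)\<close>, the word \<open>u\<close> is the part of the current block read so far.\<close>

definition B :: "('q \<times> 'y list + ('y \<Rightarrow> 'y), 'y) automaton" where
  "B = \<lparr>states = Inl ` (states A \<times> (\<Union>i<r. tuples Y i)) \<union> Inr ` H,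
    transition = (\<lambda>s y. case s of
      Inl (q, u) \<Rightarrow> if Suc (length u) < r then Inl (q, u @ [y])
        else Inl (transition A q (inv_into X \<psi> (u @ [y])), [])
    | Inr g \<Rightarrow> Inr g),
    out = (\<lambda>s. case s of Inl (q, u) \<Rightarrow> h q (length u) u | Inr g \<Rightarrow> g)\<rparr>"

section \<open>\<open>B\<close> is an automaton with state group \<open>H\<close>\<close>

lemma states_B [simp]:
  "Inl (q, u) \<in> states B \<longleftrightarrow> q \<in> states A \<and> length u < r \<and> u \<in> lists Y"
  "Inr g \<in> states B \<longleftrightarrow> g \<in> H"
  by (auto simp: B_def tuples_def image_iff)

lemma H_permutes: "g \<in> H \<Longrightarrow> g permutes Y"
  using subgroup.subset[OF H] by auto

lemma transition_A: "\<lbrakk>q \<in> states A; x \<in> X\<rbrakk> \<Longrightarrow> transition A q x \<in> states A"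
  using A by (simp add: automaton_over_def)

text \<open>The states \<open>Inl (q, u)\<close> put out only elements of \<open>H\<close> by
  \<open>h_in\<close>, perhaps too few to generate it; the states \<open>Inr g\<close> supply every
  \<open>g\<close> in \<open>H\<close>.\<close>

lemma out_B: "out B ` states B = H"
proof
  have "h q (length u) u \<in> H" if "q \<in> states A" "i < r" "u \<in> tuples Y i" for q i u
    using h_in[OF that] that(3) by (simp add: tuples_def)
  then show "out B ` states B \<subseteq> H"
    by (auto simp: B_def)
  show "H \<subseteq> out B ` states B"
    by (force simp: B_def)
qed

lemma state_group_B: "state_group Y B = H"
  unfolding state_group_def out_B
  by (rule group.generateI[OF group_symmetric_group, symmetric]) (use H in auto)

lemma transition_B:
  assumes "s \<in> states B" "y \<in> Y"
  shows "transition B s y \<in> states B"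
proof (cases s)
  case (Inl p)
  then obtain q u where s: "s = Inl (q, u)" by (cases p) auto
  with assms have q: "q \<in> states A" and u: "u \<in> lists Y" "length u < r"
    by simp_all
  have "transition B s y = (if Suc (length u) < r then Inl (q, u @ [y])
      else Inl (transition A q (inv_into X \<psi> (u @ [y])), []))"
    by (simp add: B_def s)
  \<comment> \<open>Here \<open>u\<close> has length \<open>r - 1\<close>, so \<open>y\<close>
    completes a block, which decodes to a letter of \<open>X\<close>.\<close>
  moreover have "inv_into X \<psi> (u @ [y]) \<in> X" if "\<not> Suc (length u) < r"
  proof -
    have "u @ [y] \<in> tuples Y r" using u assms(2) that by (simp add: tuples_def)
    then show ?thesis using psi by (metis bij_betw_def inv_into_into)
  qed
  ultimately show ?thesis
    using q u assms(2) r_pos transition_A by simp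
next
  case (Inr g)
  then have "transition B s y = s" by (simp add: B_def)
  with assms show ?thesis by simp
qed

lemma automaton_B: "automaton_over Y B"
proof -
  have "finite {g. g permutes Y}"
    using Y by (simp add: alphabet_def finite_permutations)
  then have "finite H"
    by (rule finite_subset[rotated]) (use H_permutes in auto)
  then have "finite (states B)"
    using A Y by (auto simp: B_def automaton_over_def alphabet_def finite_tuples)
  moreover have "states B \<noteq> {}"
    using subgroup.one_closed[OF H] by (auto simp: B_def)
  moreover have "out B s permutes Y" if "s \<in> states B" for s
    using out_B that H_permutes by blast
  ultimately show ?thesis
    using Y transition_B by (simp add: automaton_over_def)
qed

text \<open>The induction needs an arbitrary part \<open>u\<close> of the block already read. The
  rest \<open>v\<close> is nonempty since no state of \<open>B\<close> stores a complete block: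
  reading the last letter decodes the block and resets the memory.\<close>

lemma run_B_partial_block:
  assumes "length (u @ v) = r" "v \<noteq> []"
  shows "run B (Inl (q, u)) (v @ w) =
    map (\<lambda>i. h q i (take i (u @ v)) ((u @ v) ! i)) [length u..<r] @
    run B (Inl (transition A q (inv_into X \<psi> (u @ v)), [])) w"
  using assms
proof (induction v arbitrary: u)
  case (Cons y v)
  \<comment> \<open>The next output letter has index \<open>length u\<close> in the block, and its
    coordinate depends on the first \<open>length u\<close> letters, which are
    \<open>u\<close>.\<close>
  have upt: "[length u..<r] = length u # [Suc (length u)..<r]"
    using Cons.prems by (simp add: upt_conv_Cons)
  show ?case
  proof (cases "v = []")
    case True
    with Cons.prems show ?thesis unfolding upt by (simp add: B_def)
  next
    case False
    then have "Suc (length u) < r" using Cons.prems by (cases v) auto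
    then show ?thesis
      using Cons.IH[of "u @ [y]"] Cons.prems False unfolding upt by (simp add: B_def)
  qed
qed simp

text \<open>With nothing read before, the output over one block is \<open>wreath_act\<close> with
  coordinates \<open>h q\<close>, which \<open>psi_out\<close> identifies as the code of
  \<open>out A q x\<close>.\<close>

lemma run_B_block:
  assumes q: "q \<in> states A" and x: "x \<in> X"
  shows "run B (Inl (q, [])) (\<psi> x @ w) =
    \<psi> (out A q x) @ run B (Inl (transition A q x, [])) w"
proof -
  have "\<psi> x \<noteq> []" using length_psi[OF x] r_pos by auto
  moreover have "inv_into X \<psi> (\<psi> x) = x"
    using psi x by (simp add: bij_betw_def)
  ultimately show ?thesis
    using run_B_partial_block[of "[]" "\<psi> x" q w] psi_out[OF q x] psi_in[OF x] length_psi[OF x]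
    by (simp add: wreath_act_def)
qed

lemma run_B_code:
  assumes "w \<in> lists X" "q \<in> states A"
  shows "run B (Inl (q, [])) (code w) = code (run A q w)"
  using assms
  by (induction w arbitrary: q rule: lists.induct) (simp_all add: run_B_block transition_A)

section \<open>Automaton permutations of \<open>B\<close> as lifts of those of
  \<open>A\<close>\<close>

lemma start_state_B: "q \<in> states A \<Longrightarrow> Inl (q, []) \<in> states B"
  using r_pos by simp

lemma automaton_perm_B_code:
  assumes "w \<in> lists X" "q \<in> states A"
  shows "automaton_perm Y B (Inl (q, [])) (code w) = code (automaton_perm X A q w)"
  using assms by (simp add: automaton_perm_def code_in_lists run_B_code)

lemma automaton_perm_B_in_code_perms:
  assumes q: "q \<in> states A"
  shows "automaton_perm Y B (Inl (q, [])) \<in> code_perms"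
proof -
  have "automaton_perm Y B (Inl (q, [])) ` code ` lists X =
      code ` automaton_perm X A q ` lists X"
    using automaton_perm_B_code[OF _ q] by (simp add: image_image)
  \<comment> \<open>The automaton permutation of \<open>A\<close> is onto \<open>lists X\<close>, so
    every code is attained.\<close>
  also have "\<dots> = code ` lists X"
    using permutes_image[OF automaton_perm_permutes[OF A q]] by simp
  finally show ?thesis
    using automaton_perm_permutes[OF automaton_B start_state_B[OF q]]
    by (simp add: code_perms_def automaton_perm_take)
qed

lemma code_restrict_automaton_perm_B:
  assumes q: "q \<in> states A"
  shows "code_restrict (automaton_perm Y B (Inl (q, []))) = automaton_perm X A q"
proof
  fix w
  show "code_restrict (automaton_perm Y B (Inl (q, []))) w = automaton_perm X A q w"
  proof (cases "w \<in> lists X")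
    case True
    moreover have "automaton_perm X A q w \<in> lists X"
      using True permutes_in_image[OF automaton_perm_permutes[OF A q]] by blast
    ultimately show ?thesis
      using q by (intro code_restrict_eqI automaton_perm_B_code)
  next
    case False
    then show ?thesis unfolding code_restrict_def automaton_perm_def by simp
  qed
qed

lemma generated_by_B:
  assumes "generated_by_automaton \<Gamma> X A"
  shows "generated_by_automaton \<Gamma> Y B"
proof -
  obtain T where T: "T \<subseteq> states A" and
    iso: "\<Gamma> \<cong> symmetric_group (lists X)\<lparr>carrier :=
      generate (symmetric_group (lists X)) (automaton_perm X A ` T)\<rparr>"
    using assms unfolding generated_by_automaton_def by (auto simp: subset_image_iff)
  \<comment> \<open>The generator at a state \<open>q\<close> in \<open>T\<close> is replaced by the
    one of \<open>B\<close> at \<open>q\<close> with an empty block.\<close>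
  let ?S = "(\<lambda>q. automaton_perm Y B (Inl (q, []))) ` T"
  have restrict: "code_restrict ` ?S = automaton_perm X A ` T"
    unfolding image_image using T by (intro image_cong code_restrict_automaton_perm_B) auto
  have "?S \<subseteq> code_perms"
    using T automaton_perm_B_in_code_perms by blast
  from generate_code_restrict_iso[OF this]
  have "\<Gamma> \<cong> symmetric_group (lists Y)\<lparr>carrier := generate (symmetric_group (lists Y)) ?S\<rparr>"
    unfolding restrict by (rule iso_trans[OF iso])
  moreover have "?S \<subseteq> automaton_perm Y B ` states B"
    using T start_state_B by blast
  ultimately show ?thesis
    unfolding generated_by_automaton_def by blast
qed

end

section \<open>Wreath coordinates of the outputs and the final automaton\<close>

theorem theorem2:
  fixes G :: "('x \<Rightarrow> 'x) set" and X :: "'x set"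
    and H :: "('y \<Rightarrow> 'y) set" and Y :: "'y set"
    and \<Gamma> :: "('g, 'm) monoid_scheme" and A :: "('q, 'x) automaton"
  assumes "finite_perm_group G X"
    and "finite_perm_group H Y"
    and "\<exists>r\<ge>1. \<exists>K. subgroup K (symmetric_group (tuples Y r)\<lparr>carrier := wreath_power H Y r\<rparr>) \<and>
                    perm_isomorphic G X K (tuples Y r)"
    and "group \<Gamma>"
    and "automaton_over X A"
    and "state_group X A = G"
    and "generated_by_automaton \<Gamma> X A"
  shows "\<exists>B :: (nat, 'y) automaton.
           automaton_over Y B \<and> state_group Y B = H \<and> generated_by_automaton \<Gamma> Y B"
proof -
  have X: "alphabet X" using assms(5) by (simp add: automaton_over_def)
  have H: "finite Y" "subgroup H (symmetric_group Y)"
    using assms(2) by (simp_all add: finite_perm_group_def)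
  obtain r K where r: "r \<ge> 1"
    and K: "subgroup K (symmetric_group (tuples Y r)\<lparr>carrier := wreath_power H Y r\<rparr>)"
    and iso: "perm_isomorphic G X K (tuples Y r)"
    using assms(3) by blast
  obtain \<phi> \<psi>
    where phi: "\<phi> \<in> iso (symmetric_group X\<lparr>carrier := G\<rparr>) (symmetric_group (tuples Y r)\<lparr>carrier := K\<rparr>)"
      and psi: "bij_betw \<psi> X (tuples Y r)"
      and equivariant: "\<forall>x\<in>X. \<forall>g\<in>G. \<psi> (g x) = \<phi> g (\<psi> x)"
    using iso unfolding perm_isomorphic_def by blast
  \<comment> \<open>\<open>\<psi>\<close> matches \<open>X\<close> with the tuples, so there are at
    least two of them; this forces two distinct letters in \<open>Y\<close>.\<close>
  have card: "card (tuples Y r) > 1"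
    using X bij_betw_same_card[OF psi] by (simp add: alphabet_def)
  have "\<not> Y \<subseteq> {y}" for y
  proof
    assume "Y \<subseteq> {y}"
    then have "card (tuples Y r) \<le> card {replicate r y}"
      by (intro card_mono tuples_subset_singleton) auto
    then show False using card by simp
  qed
  then have Y: "alphabet Y"
    using H(1) by (metis alphabet_def card_1_singletonE card_eq_0_iff empty_subsetI less_one
        linorder_neqE_nat order_refl)
  \<comment> \<open>Each output is a generator of \<open>G\<close>, so \<open>\<phi>\<close> sends
    it into \<open>K\<close> and hence into the wreath product; equivariance of
    \<open>\<psi>\<close> makes the coordinates found there the required \<open>h\<close>.\<close>
  have "\<exists>h. (\<forall>i<r. \<forall>u\<in>tuples Y i. h i u \<in> H) \<and>
      (\<forall>x\<in>X. \<psi> (out A q x) = wreath_act Y r h (\<psi> x))" if q: "q \<in> states A" for q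
  proof -
    have G: "out A q \<in> G"
      using assms(6) q by (auto simp: state_group_def intro: generate.incl)
    then have "\<phi> (out A q) \<in> K"
      using phi by (auto simp: iso_def hom_def)
    then have "\<phi> (out A q) \<in> wreath_power H Y r"
      using subgroup.subset[OF K] by auto
    then obtain h where "\<phi> (out A q) = wreath_act Y r h" "\<forall>i<r. \<forall>u\<in>tuples Y i. h i u \<in> H"
      by (auto simp: wreath_power_def)
    then show ?thesis
      using equivariant G by metis
  qed
  then obtain h where "\<And>q. q \<in> states A \<Longrightarrow> (\<forall>i<r. \<forall>u\<in>tuples Y i. h q i u \<in> H) \<and>
      (\<forall>x\<in>X. \<psi> (out A q x) = wreath_act Y r (h q) (\<psi> x))"
    by metis
  then interpret block_automaton X Y r \<psi> A H h
    using psi r Y H assms(5)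
    by (intro block_automaton.intro block_automaton_axioms.intro block_code.intro)
      (auto simp: alphabet_def)
  show ?thesis
    \<comment> \<open>The states of \<open>B\<close>, pairs and permutations, are renamed by natural
      numbers.\<close>
    using automaton_nat_states[OF automaton_B generated_by_B[OF assms(7)]] state_group_B by simp
qed

end
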